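(* For every $n\ge 2$, the line graph $L(\mu(C_{2n+1}))$ of the Mycielski graph of the odd cycle $C_{2n+1}$ is word-representable.
   Context: All graphs are simple. Two letters $a,b$ alternate in a word $w$ if the subsequence of $w$ consisting of all occurrences of $a$ and $b$ is of the form $abab\cdots$ or $baba\cdots$. A graph $G=(V,E)$ is word-representable if there is a word $w$ over $V$ such that for all distinct $a,b\in V$, $\overline{ab}\in E$ iff $a$ and $b$ alternate in $w$. For a graph $G$ with vertex set $[m]=\{1,\dots,m\}$ and edge set $E(G)$, the Mycielski graph $\mu(G)$ has vertex set $[m]\cup\{1',\dots,m'\}\cup\{0\}$ and edge set $E(G)\cup\{\overline{0i'} : i\in[m]\}\cup\{\overline{ji'},\overline{ij'} : \overline{ij}\in E(G)\}$. $C_{2n+1}$ is the cycle on $2n+1$ vertices. The line graph $L(G)$ has the edges of $G$ as vertices, two being adjacent iff they share an endpoint. *)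

theory Defs imports Main begin

type_synonym 'a ugraph = "'a set \<times> 'a set set"

abbreviation verts :: "'a ugraph \<Rightarrow> 'a set" where "verts G \<equiv> fst G"
abbreviation edges :: "'a ugraph \<Rightarrow> 'a set set" where "edges G \<equiv> snd G"

definition simple_graph :: "'a ugraph \<Rightarrow> bool" where
  "simple_graph G \<longleftrightarrow> edges G \<subseteq> {{u, v} | u v. u \<in> verts G \<and> v \<in> verts G \<and> u \<noteq> v}"

(* alt_word a b k is the word abab... of length k; k may be even or odd. *)
definition alt_word :: "'a \<Rightarrow> 'a \<Rightarrow> nat \<Rightarrow> 'a list" where
  "alt_word a b k = map (\<lambda>i. if even i then a else b) [0..<k]"

definition alternate :: "'a list \<Rightarrow> 'a \<Rightarrow> 'a \<Rightarrow> bool" where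
  "alternate w a b \<longleftrightarrow>
     (\<exists>k. filter (\<lambda>x. x \<in> {a, b}) w = alt_word a b k \<or>
          filter (\<lambda>x. x \<in> {a, b}) w = alt_word b a k)"

(* Letters of the vertex set are not required to occur in the word. Requiring it gives the same
   class of graphs: missing letters, each written once, can be appended to the word. *)
definition word_representable :: "'a ugraph \<Rightarrow> bool" where
  "word_representable G \<longleftrightarrow>
     (\<exists>w. set w \<subseteq> verts G \<and>
        (\<forall>a\<in>verts G. \<forall>b\<in>verts G. a \<noteq> b \<longrightarrow> ({a, b} \<in> edges G \<longleftrightarrow> alternate w a b)))"

definition line_graph :: "'a ugraph \<Rightarrow> 'a set ugraph" where
  "line_graph G =
     (edges G, {{e, f} | e f. e \<in> edges G \<and> f \<in> edges G \<and> e \<noteq> f \<and> e \<inter> f \<noteq> {}})"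

(* Orig i, Copy i and Apex are the vertices i, i' and 0 of the Mycielski graph. *)
datatype 'a mvertex = Orig 'a | Copy 'a | Apex

(* As {i, j} and {j, i} are the same edge, the last set contains both edges {j, i'} and {i, j'}. *)
definition mycielski :: "'a ugraph \<Rightarrow> 'a mvertex ugraph" where
  "mycielski G =
     (Orig ` verts G \<union> Copy ` verts G \<union> {Apex},
      {{Orig i, Orig j} | i j. {i, j} \<in> edges G}
      \<union> {{Apex, Copy i} | i. i \<in> verts G}
      \<union> {{Orig j, Copy i} | i j. {i, j} \<in> edges G})"

(* A cycle for m at least 3. *)
definition cycle_graph :: "nat \<Rightarrow> nat ugraph" where
  "cycle_graph m = ({1..m}, {{i, i + 1} | i. 1 \<le> i \<and> i < m} \<union> {{m, 1}})"

lemma simple_graph_cycle_graph: "m \<ge> 3 \<Longrightarrow> simple_graph (cycle_graph m)"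
  unfolding simple_graph_def cycle_graph_def by (fastforce simp: doubleton_eq_iff)

lemma simple_graph_mycielski: "simple_graph G \<Longrightarrow> simple_graph (mycielski G)"
  unfolding simple_graph_def mycielski_def by (fastforce simp: doubleton_eq_iff)

lemma simple_graph_line_graph: "simple_graph (line_graph G)"
  unfolding simple_graph_def line_graph_def by auto

end

(* A graph is word-representable as soon as its vertices carry a strict partial order in which
   adjacent vertices are comparable and, whenever u and v are adjacent, any two comparable elements
   of the interval from u to v are adjacent (a semi-transitive orientation). For every vertex v, the
   classes of vertices relative to v (v itself, its neighbours and non-neighbours below and above,
   and the incomparable vertices) can be listed, each in topological order, so that v fails to
   alternate with its non-neighbours while every edge x < y contributes xyxy. The representing word
   concatenates these lists over all v.

   Among the edges of the Mycielski graph of the cycle 1, ..., m, write x_i = {i, i+1},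
   a_i = {i, (i+1)'}, b_i = {i, (i-1)'} and s_i = {0, i'} (Base, Up, Down and Spoke below), with
   indices modulo m. The order is
   generated by orienting adjacent edges so that each a_i is minimal, each b_i is maximal,
   s_1 < ... < s_m and x_(m-1) < ... < x_1. To close up around the cycle there are three exceptions:
   x_(m-1) < x_m < x_1; a_m lies above s_1, x_(m-1), x_m and below b_2, b_m; dually b_1 lies above
   a_1, a_(m-1) and below s_m, x_1, x_m. *)
theory Submission imports Defs begin

section \<open>Alternating words and doubled letters\<close>

lemma alt_word_Suc_Suc: "alt_word a b (Suc (Suc k)) = a # b # alt_word a b k"
proof -
  have "[0..<Suc (Suc k)] = 0 # 1 # map (\<lambda>i. Suc (Suc i)) [0..<k]"
    by (simp add: upt_conv_Cons map_Suc_upt[symmetric] del: upt_Suc)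
  then show ?thesis
    by (simp add: alt_word_def comp_def del: upt_Suc)
qed

lemma alt_word_no_repeat:
  assumes "a \<noteq> b" shows "alt_word a b k \<noteq> xs @ [c, c] @ ys"
proof
  assume *: "alt_word a b k = xs @ [c, c] @ ys"
  then have "length (alt_word a b k) = length xs + 2 + length ys" by simp
  then have k: "k = length xs + 2 + length ys" by (simp add: alt_word_def)
  have "alt_word a b k ! length xs = c" "alt_word a b k ! Suc (length xs) = c"
    unfolding * by (simp_all add: nth_append)
  then show False
    using assms k by (auto simp: alt_word_def simp del: upt_Suc split: if_splits)
qed

text \<open>A block \<open>abab\<close> has even length, so it ends in \<open>b\<close> and the next
  block resumes with \<open>a\<close>: gluing keeps the alternation.\<close>

lemma concat_replicate_alt_word:
  "concat (replicate n [a, b, a, b]) = alt_word a b (4 * n)"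
proof (induction n)
  case 0
  then show ?case by (simp add: alt_word_def)
next
  case (Suc n)
  have "4 * Suc n = Suc (Suc (Suc (Suc (4 * n))))" by simp
  then show ?case using Suc by (simp only: alt_word_Suc_Suc) simp
qed

text \<open>Serves the non-edges: one doubled letter inside one block spoils alternation in the
  whole word.\<close>

lemma not_alternate_repeat:
  assumes "a \<noteq> b" "filter (\<lambda>x. x \<in> {a, b}) w = xs @ [c, c] @ ys"
  shows "\<not> alternate w a b"
  using assms alt_word_no_repeat[of a b] alt_word_no_repeat[of b a]
  unfolding alternate_def by metis

lemma alternate_commute: "alternate w a b \<longleftrightarrow> alternate w b a"
  unfolding alternate_def by (auto simp: insert_commute)

section \<open>From a semi-transitive order to a representing word\<close>

lemma topological_list:
  assumes "finite V" and irrefl: "\<And>x. x \<in> V \<Longrightarrow> \<not> R x x"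
    and trans: "\<And>x y z. \<lbrakk>x \<in> V; y \<in> V; z \<in> V; R x y; R y z\<rbrakk> \<Longrightarrow> R x z"
  obtains L where "distinct L" "set L = V" "sorted_wrt (\<lambda>x y. \<not> R y x) L"
proof -
  obtain xs where xs: "distinct xs" "set xs = V"
    using finite_distinct_list[OF assms(1)] by blast
  \<comment> \<open>The number of predecessors. It strictly increases along \<open>R\<close>:
    transitivity gives the inclusion of predecessor sets, and irreflexivity makes it proper.\<close>
  define key where "key x = card {y \<in> V. R y x}" for x
  define L where "L = sort_key key xs"
  have key: "key x < key y" if "x \<in> V" "y \<in> V" "R x y" for x y
  proof -
    have "{z \<in> V. R z x} \<subset> {z \<in> V. R z y}"
      using that trans irrefl by blast
    then show ?thesis
      unfolding key_def using assms(1) by (intro psubset_card_mono) auto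
  qed
  have "sorted_wrt (\<lambda>x y. key x \<le> key y) L"
    using sorted_sort_key[of key xs] by (simp add: L_def sorted_map)
  then have "sorted_wrt (\<lambda>x y. \<not> R y x) L"
    by (rule sorted_wrt_mono_rel[rotated]) (use key xs in \<open>auto simp: L_def not_less[symmetric]\<close>)
  then show thesis
    using that[of L] xs by (simp add: L_def)
qed

lemma filter_pair_sorted_wrt:
  assumes "distinct L" "a \<in> set L" "b \<in> set L" "a \<noteq> b" "sorted_wrt (\<lambda>x y. \<not> R y x) L" "R a b"
  shows "filter (\<lambda>x. x \<in> {a, b}) L = [a, b]"
proof -
  define M where "M = filter (\<lambda>x. x \<in> {a, b}) L"
  have M: "distinct M" "set M = {a, b}" "sorted_wrt (\<lambda>x y. \<not> R y x) M"
    using assms by (auto simp: M_def intro: sorted_wrt_filter)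
  then have "length M = 2"
    using assms(4) distinct_card[of M] by simp
  then obtain x y where "M = [x, y]"
    by (auto simp: length_Suc_conv numeral_2_eq_2)
  then show ?thesis
    using M assms(4,6) unfolding M_def[symmetric] by (auto simp: doubleton_eq_iff)
qed

lemma filter_pair_distinct:
  assumes "distinct L" "a \<in> set L" "b \<in> set L" "a \<noteq> b"
  shows "filter (\<lambda>x. x \<in> {a, b}) L \<in> {[a, b], [b, a]}"
proof -
  define M where "M = filter (\<lambda>x. x \<in> {a, b}) L"
  have M: "distinct M" "set M = {a, b}"
    using assms by (auto simp: M_def)
  then have "length M = 2"
    using assms(4) distinct_card[of M] by simp
  then obtain x y where "M = [x, y]"
    by (auto simp: length_Suc_conv numeral_2_eq_2)
  then show ?thesis
    using M assms(4) unfolding M_def[symmetric] by (auto simp: doubleton_eq_iff)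
qed

theorem word_representable_semi_transitive_order:
  fixes G :: "'a ugraph"
  assumes fin: "finite (verts G)"
    and irrefl: "\<And>x. x \<in> verts G \<Longrightarrow> \<not> R x x"
    and trans: "\<And>x y z. \<lbrakk>x \<in> verts G; y \<in> verts G; z \<in> verts G; R x y; R y z\<rbrakk> \<Longrightarrow> R x z"
    and comparable: "\<And>x y. \<lbrakk>x \<in> verts G; y \<in> verts G; x \<noteq> y; {x, y} \<in> edges G\<rbrakk> \<Longrightarrow> R x y \<or> R y x"
    and no_shortcut: "\<And>u p q v. \<lbrakk>u \<in> verts G; p \<in> verts G; q \<in> verts G; v \<in> verts G;
        {u, v} \<in> edges G; u = p \<or> R u p; R p q; q = v \<or> R q v\<rbrakk> \<Longrightarrow> {p, q} \<in> edges G"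
  shows "word_representable G"
proof -
  obtain L where L: "distinct L" "set L = verts G" "sorted_wrt (\<lambda>x y. \<not> R y x) L"
    using topological_list[of "verts G" R] fin irrefl trans by blast
  define E where "E x y \<longleftrightarrow> {x, y} \<in> edges G" for x y
  have E_sym: "E x y \<longleftrightarrow> E y x" for x y
    by (simp add: E_def insert_commute)
  define A where "A v x \<longleftrightarrow> R x v \<and> \<not> E x v" for v x
  define I where "I v x \<longleftrightarrow> R x v \<and> E x v" for v x
  define T where "T v x \<longleftrightarrow> x \<noteq> v \<and> \<not> R x v \<and> \<not> R v x" for v x
  define O' where "O' v x \<longleftrightarrow> R v x \<and> E v x" for v x
  define B where "B v x \<longleftrightarrow> R v x \<and> \<not> E v x" for v x
  \<comment> \<open>Every class occurs twice. Against the two copies of \<open>v\<close>, the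
    classes of non-neighbours read \<open>AAvv\<close>, \<open>TvvT\<close> and \<open>vvBB\<close>,
    each with a doubled \<open>v\<close>, while in-neighbours read \<open>IvIv\<close> and
    out-neighbours \<open>vO'vO'\<close>.\<close>
  define cls where "cls v = [A v, I v, T v, A v, (\<lambda>x. x = v), O' v, I v, (\<lambda>x. x = v), B v, T v, O' v, B v]" for v
  define W where "W v = concat (map (\<lambda>P. filter P L) (cls v))" for v
  define w where "w = concat (map W L)"
  note class_defs = A_def I_def T_def O'_def B_def
  have asym: "\<not> (R x y \<and> R y x)" if "x \<in> verts G" "y \<in> verts G" for x y
    using that irrefl trans by blast
  have filter_W: "filter (\<lambda>x. x \<in> {a, b}) (W v)
      = concat (map (\<lambda>P. filter P (filter (\<lambda>x. x \<in> {a, b}) L)) (cls v))" for a b v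
    by (simp add: W_def filter_concat comp_def conj_commute)
  have edge: "filter (\<lambda>x. x \<in> {a, b}) (W v) = [a, b, a, b]"
    if ab: "a \<in> verts G" "b \<in> verts G" "E a b" "R a b" and v: "v \<in> verts G" for a b v
  proof -
    have ne: "a \<noteq> b" using ab irrefl by blast
    have f: "filter (\<lambda>x. x \<in> {a, b}) L = [a, b]"
      using filter_pair_sorted_wrt[of L a b R] L ab ne by blast
    \<comment> \<open>These facts exclude the pairs of classes that would break \<open>abab\<close>.
      If \<open>v\<close> lies between \<open>a\<close> and \<open>b\<close>, then \<open>a\<close>
      is in \<open>I\<close> and \<open>b\<close> in \<open>O'\<close> (\<open>n1\<close>,
      \<open>n2\<close>); \<open>n3\<close> excludes \<open>a\<close> in \<open>I\<close> with
      \<open>b\<close> in \<open>A\<close>, and \<open>n4\<close> excludes \<open>a\<close> in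
      \<open>B\<close> with \<open>b\<close> in \<open>O'\<close>; \<open>t1\<close> and
      \<open>t2\<close> keep \<open>a\<close> from lying on a later side of \<open>v\<close> than
      \<open>b\<close>.\<close>
    have n1: "E a v" if "R a v" "R v b"
      using no_shortcut[of a a v b] ab v that by (auto simp: E_def)
    have n2: "E v b" if "R a v" "R v b"
      using no_shortcut[of a v b b] ab v that by (auto simp: E_def)
    have t1: "R a v" if "R b v" using trans that ab v by blast
    have t2: "R v b" if "R v a" using trans that ab v by blast
    have n3: "E b v" if "R b v" "E a v"
      using no_shortcut[of a b v v] ab v that by (auto simp: E_def)
    have n4: "E v a" if "R v a" "E v b"
      using no_shortcut[of v v a b] ab v that by (auto simp: E_def)
    consider "v = a" | "v = b" | "v \<noteq> a" "v \<noteq> b" by blast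
    then show ?thesis
    proof cases
      case 1
      then show ?thesis
        unfolding filter_W f cls_def class_defs using ne ab irrefl asym[of a b] by auto
    next
      case 2
      then show ?thesis
        unfolding filter_W f cls_def class_defs using ne ab irrefl asym[of a b] by auto
    next
      case 3
      show ?thesis
        unfolding filter_W f cls_def class_defs
        using 3 n1 n2 n3 n4 t1 t2 asym[of a v] asym[of b v] ab(1,2) v E_sym[of v a] E_sym[of v b]
        by (cases "R a v"; cases "R v a"; cases "R b v"; cases "R v b"; cases "E a v"; cases "E b v"; simp)
    qed
  qed
  have nonedge: "\<exists>xs ys. filter (\<lambda>x. x \<in> {a, b}) (W a) = xs @ [a, a] @ ys"
    if "a \<in> verts G" "b \<in> verts G" "\<not> E a b" "a \<noteq> b" for a b
  proof -
    have f: "filter (\<lambda>x. x \<in> {a, b}) L = [a, b] \<or> filter (\<lambda>x. x \<in> {a, b}) L = [b, a]"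
      using filter_pair_distinct[of L a b] L that by blast
    consider "R b a" | "R a b" | "\<not> R a b" "\<not> R b a" by blast
    then have "filter (\<lambda>x. x \<in> {a, b}) (W a) \<in> {[b, b] @ [a, a] @ [], [] @ [a, a] @ [b, b], [b] @ [a, a] @ [b]}"
      using f that irrefl[of a] asym[of a b] E_sym[of a b]
      unfolding filter_W cls_def class_defs by cases (elim disjE; simp)+
    then show ?thesis by blast
  qed
  show ?thesis
    unfolding word_representable_def
  proof (intro exI[of _ w] conjI ballI impI)
    show "set w \<subseteq> verts G"
      using L by (auto simp: w_def W_def)
    have alt: "alternate w a b" if "a \<in> verts G" "b \<in> verts G" "E a b" "R a b" for a b
    proof -
      have "filter (\<lambda>x. x \<in> {a, b}) w = concat (map (\<lambda>v. filter (\<lambda>x. x \<in> {a, b}) (W v)) L)"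
        by (simp add: w_def filter_concat comp_def)
      also have "\<dots> = concat (map (\<lambda>v. [a, b, a, b]) L)"
        using edge[OF that] L(2) by (intro arg_cong[of _ _ concat] map_cong refl) blast
      also have "\<dots> = alt_word a b (4 * length L)"
        by (simp only: map_replicate_const concat_replicate_alt_word)
      finally show ?thesis unfolding alternate_def by blast
    qed
    fix a b assume ab: "a \<in> verts G" "b \<in> verts G" "a \<noteq> b"
    show "{a, b} \<in> edges G \<longleftrightarrow> alternate w a b"
    proof
      assume "{a, b} \<in> edges G"
      then show "alternate w a b"
        using comparable[OF ab] alt[of a b] alt[of b a] ab E_sym
        by (auto simp: E_def alternate_commute[of w b a])
    next
      assume *: "alternate w a b"
      show "{a, b} \<in> edges G"
      proof (rule ccontr)
        assume "{a, b} \<notin> edges G"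
        then obtain xs ys where xy: "filter (\<lambda>x. x \<in> {a, b}) (W a) = xs @ [a, a] @ ys"
          using nonedge[of a b] ab by (auto simp: E_def)
        \<comment> \<open>Isolates the block \<open>W a\<close> in \<open>w\<close>, so that its
          factor \<open>aa\<close> persists in the restriction of \<open>w\<close>.\<close>
        obtain L1 L2 where "L = L1 @ a # L2"
          using ab L by (metis split_list)
        then have "filter (\<lambda>x. x \<in> {a, b}) w = (filter (\<lambda>x. x \<in> {a, b}) (concat (map W L1)) @ xs)
            @ [a, a] @ (ys @ filter (\<lambda>x. x \<in> {a, b}) (concat (map W L2)))"
          using xy by (simp add: w_def)
        then show False
          using * not_alternate_repeat[OF ab(3)] by blast
      qed
    qed
  qed
qed

section \<open>Coded edges of the Mycielski graph of a cycle, and their order\<close>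

datatype cedge = Base nat | Up nat | Down nat | Spoke nat

definition next_vertex :: "nat \<Rightarrow> nat \<Rightarrow> nat" where "next_vertex m i = (if i = m then 1 else Suc i)"

fun index :: "cedge \<Rightarrow> nat" where
  "index (Base i) = i" | "index (Up i) = i" | "index (Down i) = i" | "index (Spoke i) = i"

fun edge_of :: "nat \<Rightarrow> cedge \<Rightarrow> nat mvertex set" where
  "edge_of m (Base i) = {Orig i, Orig (next_vertex m i)}"
| "edge_of m (Up i) = {Orig i, Copy (next_vertex m i)}"
| "edge_of m (Down i) = {Orig i, Copy (if i = 1 then m else i - 1)}"
| "edge_of m (Spoke i) = {Apex, Copy i}"

text \<open>Adjacency in the line graph written as conditions on indices, so that the facts below
  reduce to case splits with arithmetic; \<open>adj_iff\<close> gives the link with shared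
  endpoints.\<close>

fun adj :: "nat \<Rightarrow> cedge \<Rightarrow> cedge \<Rightarrow> bool" where
  "adj m (Base i) (Base j) \<longleftrightarrow> j = next_vertex m i \<or> i = next_vertex m j"
| "adj m (Base i) (Up j) \<longleftrightarrow> j = i \<or> j = next_vertex m i"
| "adj m (Base i) (Down j) \<longleftrightarrow> j = i \<or> j = next_vertex m i"
| "adj m (Base i) (Spoke j) \<longleftrightarrow> False"
| "adj m (Up i) (Base j) \<longleftrightarrow> i = j \<or> i = next_vertex m j"
| "adj m (Up i) (Up j) \<longleftrightarrow> False"
| "adj m (Up i) (Down j) \<longleftrightarrow> j = i \<or> j = next_vertex m (next_vertex m i)"
| "adj m (Up i) (Spoke j) \<longleftrightarrow> j = next_vertex m i"
| "adj m (Down i) (Base j) \<longleftrightarrow> i = j \<or> i = next_vertex m j"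
| "adj m (Down i) (Up j) \<longleftrightarrow> i = j \<or> i = next_vertex m (next_vertex m j)"
| "adj m (Down i) (Down j) \<longleftrightarrow> False"
| "adj m (Down i) (Spoke j) \<longleftrightarrow> i = next_vertex m j"
| "adj m (Spoke i) (Base j) \<longleftrightarrow> False"
| "adj m (Spoke i) (Up j) \<longleftrightarrow> i = next_vertex m j"
| "adj m (Spoke i) (Down j) \<longleftrightarrow> j = next_vertex m i"
| "adj m (Spoke i) (Spoke j) \<longleftrightarrow> i \<noteq> j"

text \<open>Closed form of the transitive closure of the oriented adjacencies, hence the clauses
  relating non-adjacent edges.\<close>

fun below :: "nat \<Rightarrow> cedge \<Rightarrow> cedge \<Rightarrow> bool" where
  "below m (Base i) (Base j) \<longleftrightarrow> j < i \<and> i < m \<or> i = m \<and> j = 1 \<or> i = m - 1 \<and> j = m"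
| "below m (Base i) (Up j) \<longleftrightarrow> j = m \<and> m - 1 \<le> i"
| "below m (Base i) (Down j) \<longleftrightarrow> 2 \<le> j \<and> j \<le> i + 1 \<and> i < m \<or> i = m \<and> (j = 2 \<or> j = m)"
| "below m (Base i) (Spoke j) \<longleftrightarrow> False"
| "below m (Up i) (Base j) \<longleftrightarrow> j \<le> i \<and> i < m \<or> (i = 1 \<or> i = m - 1) \<and> j = m"
| "below m (Up i) (Up j) \<longleftrightarrow> (i = 1 \<or> i = m - 1) \<and> j = m"
| "below m (Up i) (Down j) \<longleftrightarrow> i < m \<and> (2 \<le> j \<or> i = 1 \<or> i = m - 1) \<or> i = m \<and> (j = 2 \<or> j = m)"
| "below m (Up i) (Spoke j) \<longleftrightarrow> i < j \<and> i < m"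
| "below m (Down i) (Base j) \<longleftrightarrow> i = 1 \<and> (j = 1 \<or> j = m)"
| "below m (Down i) (Up j) \<longleftrightarrow> i = 1 \<and> j = m"
| "below m (Down i) (Down j) \<longleftrightarrow> i = 1 \<and> (j = 2 \<or> j = m)"
| "below m (Down i) (Spoke j) \<longleftrightarrow> i = 1 \<and> j = m"
| "below m (Spoke i) (Base j) \<longleftrightarrow> False"
| "below m (Spoke i) (Up j) \<longleftrightarrow> i = 1 \<and> j = m"
| "below m (Spoke i) (Down j) \<longleftrightarrow> i < j"
| "below m (Spoke i) (Spoke j) \<longleftrightarrow> i < j"

lemma below_irrefl: "m \<ge> 4 \<Longrightarrow> \<not> below m u u"
  by (cases u) auto

lemma below_trans:
  "\<lbrakk>m \<ge> 4; index u \<in> {1..m}; index v \<in> {1..m}; index w \<in> {1..m}; below m u v; below m v w\<rbrakk> \<Longrightarrow> below m u w"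
  by (cases u; cases v; cases w; auto)

lemma adj_comparable:
  "\<lbrakk>m \<ge> 4; index u \<in> {1..m}; index v \<in> {1..m}; adj m u v\<rbrakk> \<Longrightarrow> below m u v \<or> below m v u"
  by (cases u; cases v; auto simp: next_vertex_def split: if_splits)

lemma adj_iff:
  assumes "m \<ge> 4" "index u \<in> {1..m}" "index v \<in> {1..m}"
  shows "adj m u v \<longleftrightarrow> u \<noteq> v \<and> edge_of m u \<inter> edge_of m v \<noteq> {}"
  using assms by (cases u; cases v; auto simp: next_vertex_def split: if_splits)

text \<open>With a single inner edge only three indices enter the case analysis;
  \<open>adj_interval\<close> deduces the case of two inner edges.\<close>

lemma adj_lower_interval:
  assumes "m \<ge> 4" "index u \<in> {1..m}" "index q \<in> {1..m}" "index v \<in> {1..m}"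
    "adj m u v" "below m u q" "below m q v"
  shows "adj m u q"
  using assms by (cases u; cases q; cases v; auto simp: next_vertex_def split: if_splits)

text \<open>The mirror image of \<open>adj_lower_interval\<close>: reflecting the cycle by i -> m +
  1 - i swaps \<open>Up\<close> and \<open>Down\<close>, preserves adjacency and reverses
  \<open>below\<close>.\<close>

lemma adj_upper_interval:
  assumes "m \<ge> 4" "index u \<in> {1..m}" "index p \<in> {1..m}" "index v \<in> {1..m}"
    "adj m u v" "below m u p" "below m p v"
  shows "adj m p v"
  using assms by (cases u; cases p; cases v; auto simp: next_vertex_def split: if_splits)

text \<open>This holds because the Mycielski graph of a triangle-free graph is triangle-free.\<close>

lemma adj_common_neighbour:
  assumes "m \<ge> 4" "index u \<in> {1..m}" "index v \<in> {1..m}" "index p \<in> {1..m}"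
    "adj m u v" "adj m u p" "adj m p v"
  shows "edge_of m u \<inter> edge_of m v \<subseteq> edge_of m p"
  using assms by (cases u; cases v; cases p; auto simp: next_vertex_def split: if_splits)

text \<open>If \<open>p\<close> and \<open>q\<close> are both strictly inside, each is adjacent to
  \<open>u\<close> and to \<open>v\<close>, hence contains the endpoint shared by \<open>u\<close>
  and \<open>v\<close>; so \<open>p\<close> and \<open>q\<close> meet there. Otherwise one of them
  is an end of the interval and a one-element lemma applies.\<close>

lemma adj_interval:
  assumes m: "m \<ge> 4"
    and index: "index u \<in> {1..m}" "index p \<in> {1..m}" "index q \<in> {1..m}" "index v \<in> {1..m}"
    and uv: "adj m u v" and up: "u = p \<or> below m u p" and pq: "below m p q" and qv: "q = v \<or> below m q v"
  shows "adj m p q"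
proof (cases "u = p \<or> q = v")
  case True
  then show ?thesis
    using adj_lower_interval[of m u q v] adj_upper_interval[of m u p v] assms by blast
next
  case False
  then have "below m u q" "below m p v"
    using up pq qv below_trans[OF m] index by blast+
  then have "adj m u p" "adj m p v" "adj m u q" "adj m q v"
    using adj_lower_interval[OF m] adj_upper_interval[OF m] False up qv uv index by blast+
  then have "edge_of m u \<inter> edge_of m v \<subseteq> edge_of m p \<inter> edge_of m q"
    using adj_common_neighbour[OF m] index uv by blast
  moreover have "edge_of m u \<inter> edge_of m v \<noteq> {}"
    using adj_iff[OF m] index uv by blast
  moreover have "p \<noteq> q"
    using pq below_irrefl[OF m] by blast
  ultimately show ?thesis
    using adj_iff[OF m] index by blast
qed

section \<open>Transfer from codes to the line graph\<close>

lemma verts_line_graph: "verts (line_graph G) = edges G"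
  by (simp add: line_graph_def)

lemma mem_edges_line_graph:
  "{e, f} \<in> edges (line_graph G) \<longleftrightarrow> e \<in> edges G \<and> f \<in> edges G \<and> e \<noteq> f \<and> e \<inter> f \<noteq> {}"
  by (auto simp: line_graph_def doubleton_eq_iff)

lemma verts_cycle_graph: "verts (cycle_graph m) = {1..m}"
  by (simp add: cycle_graph_def)

lemma mem_edges_cycle_graph:
  assumes "m \<ge> 3"
  shows "{i, j} \<in> edges (cycle_graph m) \<longleftrightarrow>
    i \<in> {1..m} \<and> j \<in> {1..m} \<and> (j = next_vertex m i \<or> i = next_vertex m j)"
  using assms by (auto simp: cycle_graph_def next_vertex_def doubleton_eq_iff)

lemma edges_mycielski_cycle_graph:
  assumes "m \<ge> 3"
  shows "edges (mycielski (cycle_graph m)) = edge_of m ` {u. index u \<in> {1..m}}" (is "?L = ?R")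
proof
  have R: "edge_of m u \<in> ?R" if "index u \<in> {1..m}" for u
    using that by blast
  show "?L \<subseteq> ?R"
  proof
    fix e assume "e \<in> ?L"
    then consider i j where "e = {Orig i, Orig j}" "{i, j} \<in> edges (cycle_graph m)"
      | i where "e = {Apex, Copy i}" "i \<in> {1..m}"
      | i j where "e = {Orig j, Copy i}" "{i, j} \<in> edges (cycle_graph m)"
      unfolding mycielski_def verts_cycle_graph snd_conv by blast
    then show "e \<in> ?R"
    proof cases
      case 1
      \<comment> \<open>The unordered pair may run either way around the cycle; the code is the one
        indexed by the earlier vertex.\<close>
      then have "e = edge_of m (Base i) \<and> i \<in> {1..m} \<or> e = edge_of m (Base j) \<and> j \<in> {1..m}"
        using mem_edges_cycle_graph[OF assms] by (auto simp: insert_commute)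
      then show ?thesis using R[of "Base i"] R[of "Base j"] by (metis index.simps(1))
    next
      case 2
      then show ?thesis using R[of "Spoke i"] by simp
    next
      case 3
      then have ij: "i \<in> {1..m}" "j \<in> {1..m}" "j = next_vertex m i \<or> i = next_vertex m j"
        using mem_edges_cycle_graph[OF assms] by blast+
      \<comment> \<open>The predecessor used in \<open>Down\<close> inverts
        \<open>next_vertex\<close>.\<close>
      have "i = (if j = 1 then m else j - 1)" if "j = next_vertex m i"
        using that ij(1) assms by (auto simp: next_vertex_def)
      then have "e = edge_of m (Up j) \<or> e = edge_of m (Down j)"
        using 3(1) ij(3) by (metis edge_of.simps(2,3))
      then show ?thesis using R[of "Up j"] R[of "Down j"] ij(2) by (metis index.simps(2,3))
    qed
  qed
  have "edge_of m u \<in> ?L" if "index u \<in> {1..m}" for u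
  proof (cases u)
    case (Base i)
    then have "{i, next_vertex m i} \<in> edges (cycle_graph m)"
      using that assms by (subst mem_edges_cycle_graph) (auto simp: next_vertex_def)
    then show ?thesis using Base unfolding mycielski_def by fastforce
  next
    case (Up i)
    then have "{next_vertex m i, i} \<in> edges (cycle_graph m)"
      using that assms by (subst mem_edges_cycle_graph) (auto simp: next_vertex_def)
    then show ?thesis using Up unfolding mycielski_def by fastforce
  next
    case (Down i)
    then have "{if i = 1 then m else i - 1, i} \<in> edges (cycle_graph m)"
      using that assms by (subst mem_edges_cycle_graph) (auto simp: next_vertex_def)
    then show ?thesis unfolding Down mycielski_def edge_of.simps snd_conv by blast
  next
    case (Spoke i)
    then show ?thesis using that unfolding mycielski_def by (auto simp: cycle_graph_def)
  qed
  then show "?R \<subseteq> ?L" by auto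
qed

text \<open>The bound 4 excludes the triangle, where \<open>adj_common_neighbour\<close> fails: its
  three edges are pairwise adjacent without a common endpoint.\<close>

lemma word_representable_line_graph_mycielski_cycle_graph:
  assumes m: "m \<ge> 4"
  shows "word_representable (line_graph (mycielski (cycle_graph m)))"
proof -
  define V where "V = {u. index u \<in> {1..m}}"
  \<comment> \<open>A chosen code for each edge. Since \<open>edge_of m\<close> recovers the edge,
    distinct edges get distinct codes, and \<open>adj\<close> and \<open>below\<close> can be pulled
    back along \<open>c\<close>.\<close>
  define c where "c = inv_into V (edge_of m)"
  let ?G = "line_graph (mycielski (cycle_graph m))"
  have verts: "verts ?G = edge_of m ` V"
    using edges_mycielski_cycle_graph[of m] m by (simp add: verts_line_graph V_def)
  have c: "index (c e) \<in> {1..m}" "edge_of m (c e) = e" if "e \<in> verts ?G" for e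
    using that inv_into_into[of e "edge_of m" V] f_inv_into_f[of e "edge_of m" V]
    unfolding verts c_def[symmetric] by (auto simp: V_def)
  have "V \<subseteq> (Base ` {1..m} \<union> Up ` {1..m}) \<union> (Down ` {1..m} \<union> Spoke ` {1..m})"
  proof
    fix u assume "u \<in> V"
    then show "u \<in> (Base ` {1..m} \<union> Up ` {1..m}) \<union> (Down ` {1..m} \<union> Spoke ` {1..m})"
      by (cases u) (auto simp: V_def)
  qed
  then have fin: "finite (verts ?G)"
    unfolding verts by (intro finite_imageI) (auto intro: finite_subset)
  have edges: "{e, f} \<in> edges ?G \<longleftrightarrow> adj m (c e) (c f)" if "e \<in> verts ?G" "f \<in> verts ?G" for e f
  proof -
    have "{e, f} \<in> edges ?G \<longleftrightarrow> e \<noteq> f \<and> e \<inter> f \<noteq> {}"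
      using that by (simp add: mem_edges_line_graph verts_line_graph)
    also have "\<dots> \<longleftrightarrow> adj m (c e) (c f)"
      using adj_iff[OF m c(1)[OF that(1)] c(1)[OF that(2)]] c(2)[OF that(1)] c(2)[OF that(2)]
      by metis
    finally show ?thesis .
  qed
  show ?thesis
  proof (rule word_representable_semi_transitive_order[where R = "\<lambda>e f. below m (c e) (c f)"])
    show "finite (verts ?G)" by (rule fin)
    show "\<not> below m (c e) (c e)" for e
      by (rule below_irrefl[OF m])
    show "below m (c e) (c g)"
      if "e \<in> verts ?G" "f \<in> verts ?G" "g \<in> verts ?G" "below m (c e) (c f)" "below m (c f) (c g)"
      for e f g
      using below_trans[OF m] c(1) that by blast
    show "below m (c e) (c f) \<or> below m (c f) (c e)"
      if "e \<in> verts ?G" "f \<in> verts ?G" "{e, f} \<in> edges ?G" for e f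
      using adj_comparable[OF m] c(1) that edges by blast
    show "{p, q} \<in> edges ?G"
      if v: "u \<in> verts ?G" "p \<in> verts ?G" "q \<in> verts ?G" "v \<in> verts ?G"
        and "{u, v} \<in> edges ?G" "u = p \<or> below m (c u) (c p)" "below m (c p) (c q)"
          "q = v \<or> below m (c q) (c v)"
      for u p q v
      using adj_interval[OF m c(1)[OF v(1)] c(1)[OF v(2)] c(1)[OF v(3)] c(1)[OF v(4)]] that edges by metis
  qed
qed

theorem theorem2:
  fixes n :: nat
  assumes "n \<ge> 2"
  shows "word_representable (line_graph (mycielski (cycle_graph (2 * n + 1))))"
  using assms by (intro word_representable_line_graph_mycielski_cycle_graph) simp

end
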